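(* Let $p\ge 1$ be real, and let $d\ge 1$ and $k\ge 1$ be integers. Let $f:(0,\infty)\times\mathbb{N}^k\to[0,\infty)$, $(L,n)\mapsto f(L|n)$, satisfy: (1) ($p$-homogeneity) $f(L|n)=L^p f(1|n)$ for every $n\in\mathbb{N}^k$ and $L>0$; (2) (boundedness) there is a constant $C<\infty$ such that $f(1|n)\le C$ for every $n\in\mathbb{N}^k$; (3) (monotonicity) $f(1|n)\le f(1|m)$ for every $m,n\in\mathbb{N}^k$ such that $m_i\le n_i$ for $i=1,\dots,k$. Define, for $L>0$, $$f(L)=\mathbb{E}\left[f(L|N_L)\right],$$ where $N_L=(N_{L,i})_{i=1}^k$ are i.i.d. Poisson random variables with parameter $L^d$. Then $$\liminf_{n\to\infty} n^{\frac pd} f(1|(n,\dots,n))=\liminf_{L\to\infty} f(L)\quad\text{and}\quad \limsup_{n\to\infty} n^{\frac pd} f(1|(n,\dots,n))=\limsup_{L\to\infty} f(L).$$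
   Context: Here $\mathbb{N}=\{0,1,2,\dots\}$. The limits as $n\to\infty$ are along integers and those as $L\to\infty$ are along real numbers; the equalities hold in $[0,\infty]$. *)

theory Defs
  imports "HOL-Probability.Probability"
begin

(* Measurability of each X i is part of indep_vars. The library's poisson_pmf r is the
   Poisson distribution only for r > 0. *)
definition iid_poisson :: "'a measure \<Rightarrow> real \<Rightarrow> ('k \<Rightarrow> 'a \<Rightarrow> nat) \<Rightarrow> bool" where
  "iid_poisson M r X \<longleftrightarrow>
     prob_space M \<and>
     prob_space.indep_vars M (\<lambda>_. count_space UNIV) X UNIV \<and>
     (\<forall>i. distr M (count_space UNIV) (X i) = measure_pmf (poisson_pmf r))"

(* f(L) = E[f(L|N)], with values in [0,\<infinity>]: the integrand is nonnegative, so the expectation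
   is taken as a nonnegative integral, without any integrability requirement. *)
definition mean_at :: "(real \<Rightarrow> ('k \<Rightarrow> nat) \<Rightarrow> real) \<Rightarrow> 'a measure \<Rightarrow> ('k \<Rightarrow> 'a \<Rightarrow> nat) \<Rightarrow> real \<Rightarrow> ennreal" where
  "mean_at f M X L = (\<integral>\<^sup>+ \<omega>. ennreal (f L (\<lambda>i. X i \<omega>)) \<partial>M)"

end

theory Submission
  imports Defs "HOL-Real_Asymp.Real_Asymp"
begin

text \<open>
  By a Chernoff bound, all coordinates of \<open>N\<^sub>L\<close> lie within \<open>\<epsilon> L\<^sup>d\<close> of \<open>L\<^sup>d\<close> outside an event of
  probability exponentially small in \<open>L\<^sup>d\<close>, which beats the factor \<open>L\<^sup>p\<close> coming from homogeneity
  and boundedness. On the good event, monotonicity compares \<open>f(L|N\<^sub>L)\<close> with \<open>f(L|(m,\<dots>,m))\<close> for \<open>m\<close>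
  near \<open>(1 \<plusminus> \<epsilon>) L\<^sup>d\<close>, that is, with \<open>m\<^sup>p\<^sup>/\<^sup>d f(1|(m,\<dots>,m))\<close> up to a factor close to 1. Since \<open>m\<close> can be
  chosen from \<open>L\<close> and \<open>L\<close> from \<open>m\<close>, both the lower and the upper limits agree.
\<close>

section \<open>Chernoff bounds for Poisson variables\<close>

text \<open>For negative \<open>t\<close>, \<open>exp t = 1 / exp (- t)\<close> is at most
  \<open>1 / (1 - t)\<close>, and the product of \<open>1 + t + t\<^sup>2\<close> with
  \<open>1 - t\<close> is 1 - t^3, which is at least 1.\<close>

lemma exp_le_quadratic:
  fixes t :: real
  assumes "\<bar>t\<bar> \<le> 1"
  shows "exp t \<le> 1 + t + t\<^sup>2"
proof (cases "t \<ge> 0")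
  case True
  then show ?thesis using exp_bound[of t] assms by simp
next
  case False
  have pos: "0 < 1 - t" using False by simp
  have "exp t = 1 / exp (- t)" by (simp add: exp_minus field_simps)
  also have "\<dots> \<le> 1 / (1 - t)"
    using exp_ge_add_one_self[of "- t"] pos by (intro divide_left_mono mult_pos_pos) auto
  also have "\<dots> \<le> 1 + t + t\<^sup>2"
  proof -
    have "t ^ 3 \<le> 0" using False by (simp add: power_le_zero_eq)
    then have "1 \<le> (1 + t + t\<^sup>2) * (1 - t)"
      by (simp add: algebra_simps power2_eq_square power3_eq_cube)
    then show ?thesis using pos by (simp add: pos_divide_le_eq)
  qed
  finally show ?thesis .
qed

text \<open>This is the moment generating function of the Poisson law, obtained by summing the
  exponential series at \<open>r * exp t\<close>.\<close>

lemma nn_integral_exp_poisson: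
  assumes "r > 0"
  shows "(\<integral>\<^sup>+ n. ennreal (exp (t * real n)) \<partial>measure_pmf (poisson_pmf r)) = ennreal (exp (r * (exp t - 1)))"
proof -
  have "(\<lambda>n. (r * exp t) ^ n /\<^sub>R fact n * exp (- r)) sums (exp (r * exp t) * exp (- r))"
    by (intro sums_mult2 exp_converges)
  then have *: "(\<lambda>n. r ^ n / fact n * exp (- r) * exp (t * real n)) sums exp (r * (exp t - 1))"
    by (simp add: power_mult_distrib exp_of_nat2_mult[symmetric] field_simps exp_diff exp_minus)
  have "(\<integral>\<^sup>+ n. ennreal (exp (t * real n)) \<partial>measure_pmf (poisson_pmf r))
      = (\<Sum>n. ennreal (r ^ n / fact n * exp (- r) * exp (t * real n)))"
    using assms by (simp add: nn_integral_measure_pmf nn_integral_count_space_nat ennreal_mult[symmetric])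
  also have "\<dots> = ennreal (exp (r * (exp t - 1)))"
    using * assms by (intro suminf_ennreal_eq) auto
  finally show ?thesis .
qed

text \<open>Markov's inequality for \<open>exp (t * real n)\<close>. The sign of \<open>t\<close> is
  left free so that both tails are covered.\<close>

lemma poisson_exp_Markov:
  assumes "r > 0"
  shows "emeasure (measure_pmf (poisson_pmf r)) {n. a \<le> t * real n} \<le> ennreal (exp (r * (exp t - 1) - a))"
proof -
  let ?M = "measure_pmf (poisson_pmf r)"
  have "emeasure ?M {n. a \<le> t * real n} = (\<integral>\<^sup>+ n. indicator {n. a \<le> t * real n} n \<partial>?M)"
    by simp
  also have "\<dots> \<le> (\<integral>\<^sup>+ n. ennreal (exp (- a)) * ennreal (exp (t * real n)) \<partial>?M)"
    by (intro nn_integral_mono)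
       (auto simp: indicator_def ennreal_mult[symmetric] exp_add[symmetric])
  also have "\<dots> = ennreal (exp (- a)) * ennreal (exp (r * (exp t - 1)))"
    using assms by (subst nn_integral_cmult) (simp_all only: nn_integral_exp_poisson, simp)
  also have "\<dots> = ennreal (exp (r * (exp t - 1) - a))"
    by (simp add: ennreal_mult[symmetric] exp_add[symmetric])
  finally show ?thesis .
qed

text \<open>Each tail is treated with \<open>t\<close> equal to plus or minus
  \<open>\<epsilon> / 2\<close>. The quadratic bound on \<open>exp t\<close> costs
  \<open>\<epsilon>\<^sup>2 / 4 * r\<close> in the exponent and the deviation gains
  \<open>\<epsilon>\<^sup>2 / 2 * r\<close>, which leaves the stated rate.\<close>

lemma poisson_concentration:
  assumes r: "r > 0" and e: "0 < \<epsilon>" "\<epsilon> \<le> 1"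
  shows "emeasure (measure_pmf (poisson_pmf r)) {n. \<epsilon> * r < \<bar>real n - r\<bar>}
    \<le> ennreal (2 * exp (- (\<epsilon>\<^sup>2 / 4 * r)))"
proof -
  let ?M = "measure_pmf (poisson_pmf r)"
  have tail: "emeasure ?M {n. t * r + \<epsilon>\<^sup>2 / 2 * r \<le> t * real n} \<le> ennreal (exp (- (\<epsilon>\<^sup>2 / 4 * r)))"
    if "\<bar>t\<bar> = \<epsilon> / 2" for t
  proof -
    have t2: "t\<^sup>2 = \<epsilon>\<^sup>2 / 4" using that by (metis power2_abs power_divide mult_2_right numeral_Bit0 power2_eq_square)
    have "exp t - 1 \<le> t + t\<^sup>2" using exp_le_quadratic[of t] that e by simp
    then have "r * (exp t - 1) \<le> r * (t + t\<^sup>2)" using r by (intro mult_left_mono) auto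
    then have "r * (exp t - 1) - (t * r + \<epsilon>\<^sup>2 / 2 * r) \<le> - (\<epsilon>\<^sup>2 / 4 * r)"
      unfolding t2 by (simp add: algebra_simps)
    then show ?thesis
      by (intro order_trans[OF poisson_exp_Markov[OF r]] ennreal_leI) simp
  qed
  \<comment> \<open>A deviation above or below \<open>r\<close>, multiplied by
    \<open>\<epsilon> / 2\<close>, becomes the event of \<open>tail\<close> for the positive or the
    negative \<open>t\<close>.\<close>
  have sub: "{n. \<epsilon> * r < \<bar>real n - r\<bar>} \<subseteq> {n. \<epsilon> / 2 * r + \<epsilon>\<^sup>2 / 2 * r \<le> \<epsilon> / 2 * real n}
      \<union> {n. - (\<epsilon> / 2) * r + \<epsilon>\<^sup>2 / 2 * r \<le> - (\<epsilon> / 2) * real n}"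
  proof (intro subsetI)
    fix n assume "n \<in> {n. \<epsilon> * r < \<bar>real n - r\<bar>}"
    then have "\<epsilon> / 2 * (\<epsilon> * r) \<le> \<epsilon> / 2 * \<bar>real n - r\<bar>" using e by (intro mult_left_mono) auto
    then show "n \<in> {n. \<epsilon> / 2 * r + \<epsilon>\<^sup>2 / 2 * r \<le> \<epsilon> / 2 * real n}
      \<union> {n. - (\<epsilon> / 2) * r + \<epsilon>\<^sup>2 / 2 * r \<le> - (\<epsilon> / 2) * real n}"
      by (auto simp: abs_if algebra_simps power2_eq_square split: if_splits)
  qed
  have "emeasure ?M {n. \<epsilon> * r < \<bar>real n - r\<bar>} \<le> emeasure ?M ({n. \<epsilon> / 2 * r + \<epsilon>\<^sup>2 / 2 * r \<le> \<epsilon> / 2 * real n}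
      \<union> {n. - (\<epsilon> / 2) * r + \<epsilon>\<^sup>2 / 2 * r \<le> - (\<epsilon> / 2) * real n})"
    by (intro emeasure_mono sub) auto
  also have "\<dots> \<le> emeasure ?M {n. \<epsilon> / 2 * r + \<epsilon>\<^sup>2 / 2 * r \<le> \<epsilon> / 2 * real n}
      + emeasure ?M {n. - (\<epsilon> / 2) * r + \<epsilon>\<^sup>2 / 2 * r \<le> - (\<epsilon> / 2) * real n}"
    by (intro emeasure_subadditive) auto
  also have "\<dots> \<le> ennreal (exp (- (\<epsilon>\<^sup>2 / 4 * r))) + ennreal (exp (- (\<epsilon>\<^sup>2 / 4 * r)))"
    using e by (intro add_mono tail) auto
  finally show ?thesis by (simp add: ennreal_plus[symmetric] del: ennreal_plus)
qed

text \<open>Union bound over the finitely many coordinates, each having the Poisson law.\<close>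

lemma iid_poisson_concentration:
  fixes X :: "'k::finite \<Rightarrow> 'a \<Rightarrow> nat"
  assumes X: "iid_poisson M r X" and r: "r > 0" and e: "0 < \<epsilon>" "\<epsilon> \<le> 1"
  defines "B \<equiv> {\<omega> \<in> space M. \<exists>i. \<epsilon> * r < \<bar>real (X i \<omega>) - r\<bar>}"
  shows "B \<in> sets M" "emeasure M B \<le> ennreal (2 * real CARD('k) * exp (- (\<epsilon>\<^sup>2 / 4 * r)))"
proof -
  interpret prob_space M using X by (simp add: iid_poisson_def)
  have meas[measurable]: "X i \<in> measurable M (count_space UNIV)" for i
    using X by (auto simp: iid_poisson_def indep_vars_def)
  let ?S = "{n. \<epsilon> * r < \<bar>real n - r\<bar>}"
  have B: "B = (\<Union>i\<in>UNIV. X i -` ?S \<inter> space M)" by (auto simp: B_def)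
  have sets: "X i -` ?S \<inter> space M \<in> sets M" for i by (rule measurable_sets[OF meas]) simp
  show "B \<in> sets M" unfolding B using sets by blast
  have *: "emeasure M (X i -` ?S \<inter> space M) \<le> ennreal (2 * exp (- (\<epsilon>\<^sup>2 / 4 * r)))" for i
  proof -
    have "emeasure M (X i -` ?S \<inter> space M) = emeasure (distr M (count_space UNIV) (X i)) ?S"
      by (subst emeasure_distr) auto
    then show ?thesis using X poisson_concentration[OF r e] by (simp add: iid_poisson_def)
  qed
  have "emeasure M B \<le> (\<Sum>i\<in>UNIV. emeasure M (X i -` ?S \<inter> space M))"
    unfolding B using sets by (intro emeasure_subadditive_finite) auto
  also have "\<dots> \<le> (\<Sum>i\<in>(UNIV::'k set). ennreal (2 * exp (- (\<epsilon>\<^sup>2 / 4 * r))))"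
    by (intro sum_mono *)
  also have "\<dots> = ennreal (2 * real CARD('k) * exp (- (\<epsilon>\<^sup>2 / 4 * r)))"
    by (simp add: ennreal_mult[symmetric] ennreal_of_nat_eq_real_of_nat mult_ac)
  finally show "emeasure M B \<le> ennreal (2 * real CARD('k) * exp (- (\<epsilon>\<^sup>2 / 4 * r)))" .
qed

section \<open>Bounds on the mean by values on the diagonal\<close>

text \<open>Outside the bad event every count is at least \<open>(1 - \<epsilon>) * r\<close>, hence
  at least \<open>m\<close>, and \<open>f L\<close> decreases in the counts. On the bad event the
  integrand is bounded by \<open>K\<close>.\<close>

lemma mean_at_upper:
  fixes X :: "'k::finite \<Rightarrow> 'a \<Rightarrow> nat"
  assumes X: "iid_poisson M r X" and r: "r > 0" and e: "0 < \<epsilon>" "\<epsilon> \<le> 1"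
    and mono: "\<And>m n. (\<And>i. m i \<le> n i) \<Longrightarrow> f L n \<le> f L m"
    and bound: "\<And>n. f L n \<le> K" and K: "0 \<le> K"
    and m: "real m \<le> (1 - \<epsilon>) * r"
  shows "mean_at f M X L \<le>
    ennreal (f L (\<lambda>_. m)) + ennreal (K * (2 * real CARD('k) * exp (- (\<epsilon>\<^sup>2 / 4 * r))))"
proof -
  interpret prob_space M using X by (simp add: iid_poisson_def)
  define B where "B = {\<omega> \<in> space M. \<exists>i. \<epsilon> * r < \<bar>real (X i \<omega>) - r\<bar>}"
  note B = iid_poisson_concentration[OF X r e, folded B_def]
  have "mean_at f M X L \<le> (\<integral>\<^sup>+ \<omega>. ennreal (f L (\<lambda>_. m)) + ennreal K * indicator B \<omega> \<partial>M)"
    unfolding mean_at_def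
  proof (intro nn_integral_mono)
    fix \<omega> assume w: "\<omega> \<in> space M"
    show "ennreal (f L (\<lambda>i. X i \<omega>)) \<le> ennreal (f L (\<lambda>_. m)) + ennreal K * indicator B \<omega>"
    proof (cases "\<omega> \<in> B")
      case True
      then show ?thesis using bound by (simp add: add_increasing ennreal_leI)
    next
      case False
      have "m \<le> X i \<omega>" for i
      proof -
        have "\<bar>real (X i \<omega>) - r\<bar> \<le> \<epsilon> * r" using False w by (auto simp: B_def not_less)
        then have "real m \<le> real (X i \<omega>)" using m by (simp add: algebra_simps abs_le_iff)
        then show ?thesis by simp
      qed
      then show ?thesis using False by (simp add: ennreal_leI mono)
    qed
  qed
  also have "\<dots> = ennreal (f L (\<lambda>_. m)) + ennreal K * emeasure M B"
    using B(1) by (simp add: nn_integral_add nn_integral_cmult_indicator emeasure_space_1)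
  also have "\<dots> \<le> ennreal (f L (\<lambda>_. m)) + ennreal K * ennreal (2 * real CARD('k) * exp (- (\<epsilon>\<^sup>2 / 4 * r)))"
    by (intro add_left_mono mult_left_mono B(2)) auto
  finally show ?thesis using K by (simp add: ennreal_mult)
qed

text \<open>The bad event is discarded. On its complement every count is at most \<open>m\<close>,
  so the integrand is at least the diagonal value. If the factor in parentheses is negative,
  \<open>ennreal\<close> sends the left side to 0.\<close>

lemma mean_at_lower:
  fixes X :: "'k::finite \<Rightarrow> 'a \<Rightarrow> nat"
  assumes X: "iid_poisson M r X" and r: "r > 0" and e: "0 < \<epsilon>" "\<epsilon> \<le> 1"
    and mono: "\<And>m n. (\<And>i. m i \<le> n i) \<Longrightarrow> f L n \<le> f L m"
    and nonneg: "\<And>n. 0 \<le> f L n"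
    and m: "(1 + \<epsilon>) * r \<le> real m"
  shows "ennreal (f L (\<lambda>_. m) * (1 - 2 * real CARD('k) * exp (- (\<epsilon>\<^sup>2 / 4 * r)))) \<le> mean_at f M X L"
proof -
  interpret prob_space M using X by (simp add: iid_poisson_def)
  define B where "B = {\<omega> \<in> space M. \<exists>i. \<epsilon> * r < \<bar>real (X i \<omega>) - r\<bar>}"
  note B = iid_poisson_concentration[OF X r e, folded B_def]
  let ?b = "2 * real CARD('k) * exp (- (\<epsilon>\<^sup>2 / 4 * r))"
  have "prob B \<le> ?b" using B(2) by (simp add: emeasure_eq_measure)
  then have "1 - ?b \<le> prob (space M - B)" using B(1) by (simp add: prob_compl)
  then have "ennreal (f L (\<lambda>_. m) * (1 - ?b)) \<le> ennreal (f L (\<lambda>_. m) * prob (space M - B))"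
    by (intro ennreal_leI mult_left_mono nonneg)
  also have "\<dots> = (\<integral>\<^sup>+ \<omega>. ennreal (f L (\<lambda>_. m)) * indicator (space M - B) \<omega> \<partial>M)"
    using B(1) by (simp add: nn_integral_cmult_indicator emeasure_eq_measure ennreal_mult nonneg)
  also have "\<dots> \<le> mean_at f M X L"
    unfolding mean_at_def
  proof (intro nn_integral_mono)
    fix \<omega> assume w: "\<omega> \<in> space M"
    show "ennreal (f L (\<lambda>_. m)) * indicator (space M - B) \<omega> \<le> ennreal (f L (\<lambda>i. X i \<omega>))"
    proof (cases "\<omega> \<in> B")
      case False
      have "X i \<omega> \<le> m" for i
      proof -
        have "\<bar>real (X i \<omega>) - r\<bar> \<le> \<epsilon> * r" using False w by (auto simp: B_def not_less)
        then have "real (X i \<omega>) \<le> real m" using m by (simp add: algebra_simps abs_le_iff)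
        then show ?thesis by simp
      qed
      then show ?thesis using False w by (simp add: ennreal_leI mono)
    qed simp
  qed
  finally show ?thesis .
qed

section \<open>Transfer of upper and lower limits between filters\<close>

text \<open>Sampling \<open>G\<close> along \<open>h\<close> cannot raise its upper limit, and an
  affine map with finite slope is monotone and continuous on \<open>ennreal\<close>, so it commutes
  with \<open>Limsup\<close>.\<close>

lemma Limsup_le_affine_ennreal:
  fixes F :: "'a \<Rightarrow> ennreal" and G :: "'b \<Rightarrow> ennreal"
  assumes h: "filterlim h B A" and A: "A \<noteq> bot" and c: "c < top"
    and le: "\<forall>\<^sub>F x in A. F x \<le> c * G (h x) + e"
  shows "Limsup A F \<le> c * Limsup B G + e"
proof -
  have cont: "continuous_on UNIV (\<lambda>x. c * x + e)"
    using c by (intro continuous_on_add_ennreal ennreal_continuous_on_cmult continuous_on_id continuous_on_const)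
  have mono: "mono (\<lambda>x. c * x + e)" by (auto intro!: monoI add_right_mono mult_left_mono)
  have "Limsup A F \<le> Limsup A (\<lambda>x. c * G (h x) + e)" using le by (rule Limsup_mono)
  also have "\<dots> = c * Limsup A (\<lambda>x. G (h x)) + e"
    by (rule Limsup_compose_continuous_mono[OF cont mono A])
  also have "\<dots> \<le> c * Limsup B G + e"
  proof -
    have "Limsup A (\<lambda>x. G (h x)) \<le> Limsup (filtermap h A) G" by (rule Limsup_filtermap_ge)
    also have "\<dots> \<le> Limsup B G"
      using h unfolding filterlim_def Limsup_def le_filter_def by (intro INF_superset_mono) auto
    finally show ?thesis by (intro add_right_mono mult_left_mono) auto
  qed
  finally show ?thesis .
qed

text \<open>Here sampling cannot lower the lower limit, so it is the smaller function
  \<open>F\<close> that is sampled, and \<open>h\<close> runs in the direction opposite to the one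
  for \<open>Limsup\<close>.\<close>

lemma Liminf_le_affine_ennreal:
  fixes F :: "'a \<Rightarrow> ennreal" and G :: "'b \<Rightarrow> ennreal"
  assumes h: "filterlim h A B" and B: "B \<noteq> bot" and c: "c < top"
    and le: "\<forall>\<^sub>F x in B. F (h x) \<le> c * G x + e"
  shows "Liminf A F \<le> c * Liminf B G + e"
proof -
  have cont: "continuous_on UNIV (\<lambda>x. c * x + e)"
    using c by (intro continuous_on_add_ennreal ennreal_continuous_on_cmult continuous_on_id continuous_on_const)
  have mono: "mono (\<lambda>x. c * x + e)" by (auto intro!: monoI add_right_mono mult_left_mono)
  have "Liminf A F \<le> Liminf (filtermap h B) F"
    using h unfolding filterlim_def Liminf_def le_filter_def by (intro SUP_subset_mono) auto
  also have "\<dots> \<le> Liminf B (\<lambda>x. F (h x))" by (rule Liminf_filtermap_le)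
  also have "\<dots> \<le> Liminf B (\<lambda>x. c * G x + e)" using le by (rule Liminf_mono)
  also have "\<dots> = c * Liminf B G + e"
    by (rule Liminf_compose_continuous_mono[OF cont mono B])
  finally show ?thesis .
qed

text \<open>Let \<open>c\<close> decrease to 1: for finite \<open>y\<close> the right side tends to
  \<open>y\<close>, and for infinite \<open>y\<close> nothing is claimed.\<close>

lemma ennreal_le_affine_limit:
  fixes x y :: ennreal
  assumes "\<And>c::real. c > 1 \<Longrightarrow> x \<le> ennreal c * y + ennreal (c - 1)"
  shows "x \<le> y"
proof (cases y rule: ennreal_cases)
  case (real r)
  have "((\<lambda>c. ennreal (c * r + (c - 1))) \<longlongrightarrow> ennreal (1 * r + (1 - 1))) (at_right 1)"
    by (intro tendsto_intros)
  moreover have "\<forall>\<^sub>F c in at_right (1::real). x \<le> ennreal (c * r + (c - 1))"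
    unfolding eventually_at_filter
  proof (intro always_eventually allI impI)
    fix c :: real assume "c \<noteq> 1" "c \<in> {1<..}"
    then show "x \<le> ennreal (c * r + (c - 1))"
      using assms[of c] real by (simp add: ennreal_mult ennreal_plus)
  qed
  ultimately show ?thesis using real by (simp add: tendsto_lowerbound)
qed simp

text \<open>
  Limits over \<open>m\<close> and over \<open>L\<close> are compared in both directions: \<open>\<mu>\<close> picks an integer in the window
  belonging to \<open>L\<close>, and \<open>\<nu>\<close> a real \<open>L\<close> whose window contains \<open>n\<close>.
\<close>
lemma comparable_scales:
  fixes s t :: real and P :: "nat \<Rightarrow> real \<Rightarrow> bool"
  assumes d: "d \<ge> 1" and st: "0 < s" "s < t"
    and ev: "\<forall>\<^sub>F L in at_top. \<forall>m. s * L ^ d \<le> real m \<longrightarrow> real m \<le> t * L ^ d \<longrightarrow> P m L"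
  obtains \<mu> \<nu> where
    "filterlim \<mu> sequentially at_top" "\<forall>\<^sub>F L in at_top. P (\<mu> L) L"
    "filterlim \<nu> at_top sequentially" "\<forall>\<^sub>F n in sequentially. P n (\<nu> n)"
proof
  have pow: "filterlim (\<lambda>L::real. L ^ d) at_top at_top"
    using d by (intro filterlim_pow_at_top filterlim_ident) auto
  \<comment> \<open>\<open>\<mu> L\<close> is the integer part of the upper end of the
    window.\<close>
  show "filterlim (\<lambda>L. nat \<lfloor>t * L ^ d\<rfloor>) sequentially at_top"
    using st by (intro filterlim_compose[OF filterlim_nat_sequentially]
        filterlim_compose[OF filterlim_floor_sequentially]
        filterlim_tendsto_pos_mult_at_top[OF tendsto_const _ pow]) auto
  \<comment> \<open>From here on the window has length at least 1, so rounding its upper end down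
    stays inside it.\<close>
  have "\<forall>\<^sub>F L in at_top. 1 / (t - s) \<le> L ^ d"
    using pow by (simp add: filterlim_at_top)
  with ev eventually_gt_at_top[of 0] show "\<forall>\<^sub>F L in at_top. P (nat \<lfloor>t * L ^ d\<rfloor>) L"
  proof eventually_elim
    case (elim L)
    have "1 \<le> t * L ^ d - s * L ^ d" using elim(3) st by (simp add: field_simps)
    moreover have "0 \<le> t * L ^ d" using st elim by simp
    ultimately show ?case using elim(1) by (auto intro!: elim(1)[rule_format] simp: of_nat_nat) linarith
  qed
  \<comment> \<open>\<open>\<nu> n\<close> solves \<open>t * L ^ d = real n\<close> for
    \<open>L\<close>, which makes \<open>n\<close> exactly the upper end of its window.\<close>
  have lim: "filterlim (\<lambda>n. root d (real n / t)) at_top sequentially"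
  proof -
    have "filterlim (\<lambda>n. real n / t) at_top sequentially"
      using st filterlim_tendsto_pos_mult_at_top[OF tendsto_const[of "1/t"] _ filterlim_real_sequentially]
      by simp
    moreover have "filterlim (root d) at_top at_top"
      unfolding filterlim_at_top
    proof
      fix Z :: real
      have "\<forall>\<^sub>F x in at_top. \<bar>Z\<bar> ^ d \<le> x" by (rule eventually_ge_at_top)
      then show "\<forall>\<^sub>F x in at_top. Z \<le> root d x"
      proof eventually_elim
        case (elim x)
        have "\<bar>Z\<bar> = root d (\<bar>Z\<bar> ^ d)" using d by (simp add: real_root_power_cancel)
        also have "\<dots> \<le> root d x" using d elim by simp
        finally show ?case by simp
      qed
    qed
    ultimately show ?thesis by (rule filterlim_compose[rotated])
  qed
  then show "filterlim (\<lambda>n. root d (real n / t)) at_top sequentially" .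
  show "\<forall>\<^sub>F n in sequentially. P n (root d (real n / t))"
    using eventually_compose_filterlim[OF ev lim]
  proof eventually_elim
    case (elim n)
    have "root d (real n / t) ^ d = real n / t" using d st by simp
    moreover have "s * (real n / t) \<le> real n"
      using mult_right_mono[of s t "real n"] st by (simp add: field_simps)
    ultimately show ?case using elim st by auto
  qed
qed


section \<open>Comparison of the diagonal sequence with the Poisson means\<close>

theorem proposition6p1:
  fixes p :: real and d :: nat
    and f :: "real \<Rightarrow> ('k::finite \<Rightarrow> nat) \<Rightarrow> real"
    and M :: "real \<Rightarrow> 'a measure"
    and N :: "real \<Rightarrow> 'k \<Rightarrow> 'a \<Rightarrow> nat"
  assumes p: "p \<ge> 1" and d: "d \<ge> 1"
    and nonneg: "\<And>L n. L > 0 \<Longrightarrow> f L n \<ge> 0"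
    and homogeneity: "\<And>L n. L > 0 \<Longrightarrow> f L n = L powr p * f 1 n"
    and boundedness: "\<exists>C. \<forall>n. f 1 n \<le> C"
    and monotonicity: "\<And>m n. (\<And>i. m i \<le> n i) \<Longrightarrow> f 1 n \<le> f 1 m"
    and poisson: "\<And>L. L > 0 \<Longrightarrow> iid_poisson (M L) (L ^ d) (N L)"
  shows "Liminf sequentially (\<lambda>n. ennreal (real n powr (p / real d) * f 1 (\<lambda>_. n)))
           = Liminf at_top (\<lambda>L::real. mean_at f (M L) (N L) L)
         \<and> Limsup sequentially (\<lambda>n. ennreal (real n powr (p / real d) * f 1 (\<lambda>_. n)))
           = Limsup at_top (\<lambda>L::real. mean_at f (M L) (N L) L)"
proof -
  define q where "q = p / real d"
  define a where "a n = ennreal (real n powr q * f 1 (\<lambda>_. n))" for n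
  define F where "F L = mean_at f (M L) (N L) L" for L
  obtain C where C: "f 1 n \<le> C" for n using boundedness by blast
  have C0: "0 \<le> C" using nonneg[of 1] C order_trans zero_less_one by blast
  have q: "q > 0" using p d by (simp add: q_def)
  \<comment> \<open>This expresses the homogeneity factor through the Poisson parameter
    \<open>L ^ d\<close>, the scale on which the error decays exponentially.\<close>
  have Lp: "L powr p = (L ^ d) powr q" if "L > 0" for L :: real
    using that d by (simp add: q_def powr_powr flip: powr_realpow)
  have mono: "f L n \<le> f L m" if "L > 0" "\<And>i. m i \<le> n i" for L m n
    using homogeneity[OF that(1)] monotonicity[OF that(2)] by (simp add: mult_left_mono)
  have pow: "filterlim (\<lambda>L::real. L ^ d) at_top at_top"
    using d by (intro filterlim_pow_at_top filterlim_ident) auto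

  have upper: "\<exists>s t. 0 < s \<and> s < t \<and> (\<forall>\<^sub>F L in at_top. \<forall>m. s * L ^ d \<le> real m \<longrightarrow> real m \<le> t * L ^ d \<longrightarrow>
      F L \<le> ennreal c * a m + ennreal (c - 1))" if c: "c > 1" for c :: real
  proof -
    \<comment> \<open>The lower end \<open>s\<close> gives \<open>s powr q = 1 / c\<close>, so
      replacing \<open>L powr p\<close> by \<open>real m powr q\<close> costs at most the factor
      \<open>c\<close>. The upper end \<open>t\<close> lies strictly between \<open>s\<close> and 1,
      and \<open>\<epsilon>\<close> is chosen so that \<open>t = 1 - \<epsilon>\<close>, as
      \<open>mean_at_upper\<close> requires.\<close>
    define s where "s = c powr (- 1 / q)"
    define t where "t = sqrt s"
    define \<epsilon> where "\<epsilon> = 1 - t"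
    have s: "0 < s" "s < 1" using c q by (auto simp: s_def powr_less_one)
    have t: "s < t" "t < 1" using s by (auto simp: t_def intro!: real_less_rsqrt simp: power2_eq_square)
    have e: "0 < \<epsilon>" "\<epsilon> \<le> 1" using s t by (auto simp: \<epsilon>_def)
    have sq: "s powr q = 1 / c" unfolding s_def powr_powr using q c by (simp add: powr_minus_divide)
    \<comment> \<open>The contribution of the bad event, with \<open>r\<close> standing for
      \<open>L ^ d\<close>: the exponential beats the power.\<close>
    have "((\<lambda>r. r powr q * C * (2 * real CARD('k) * exp (- (\<epsilon>\<^sup>2 / 4 * r)))) \<longlongrightarrow> 0) at_top"
      using e by real_asymp
    then have "\<forall>\<^sub>F r in at_top. r powr q * C * (2 * real CARD('k) * exp (- (\<epsilon>\<^sup>2 / 4 * r))) < c - 1"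
      using c by (intro order_tendstoD) auto
    from eventually_compose_filterlim[OF this pow] eventually_gt_at_top[of 0]
    have "\<forall>\<^sub>F L in at_top. \<forall>m. s * L ^ d \<le> real m \<longrightarrow> real m \<le> t * L ^ d \<longrightarrow>
        F L \<le> ennreal c * a m + ennreal (c - 1)"
    proof eventually_elim
      case (elim L)
      show ?case
      proof (intro allI impI)
        fix m assume m: "s * L ^ d \<le> real m" "real m \<le> t * L ^ d"
        have "F L \<le> ennreal (f L (\<lambda>_. m)) +
            ennreal (L powr p * C * (2 * real CARD('k) * exp (- (\<epsilon>\<^sup>2 / 4 * L ^ d))))"
          unfolding F_def using elim(2) e m(2) C C0
          by (intro mean_at_upper[OF poisson])
             (auto simp: homogeneity[of L] \<epsilon>_def intro!: mult_left_mono monotonicity)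
        also have "\<dots> \<le> ennreal c * a m + ennreal (c - 1)"
        proof (intro add_mono)
          have "(s * L ^ d) powr q \<le> real m powr q"
            using q s elim(2) m by (intro powr_mono2) auto
          then have "L powr p \<le> c * real m powr q"
            using c s elim(2) sq by (simp add: Lp powr_mult field_simps)
          then have "L powr p * f 1 (\<lambda>_. m) \<le> c * real m powr q * f 1 (\<lambda>_. m)"
            by (intro mult_right_mono nonneg) auto
          then show "ennreal (f L (\<lambda>_. m)) \<le> ennreal c * a m"
            using c elim(2) nonneg[of 1]
            by (simp add: a_def homogeneity[of L] ennreal_mult[symmetric] mult.assoc ennreal_leI)
          show "ennreal (L powr p * C * (2 * real CARD('k) * exp (- (\<epsilon>\<^sup>2 / 4 * L ^ d)))) \<le> ennreal (c - 1)"
            using elim by (intro ennreal_leI) (simp add: Lp)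
        qed
        finally show "F L \<le> ennreal c * a m + ennreal (c - 1)" .
      qed
    qed
    then show ?thesis using s t by blast
  qed

  have lower: "\<exists>s t. 0 < s \<and> s < t \<and> (\<forall>\<^sub>F L in at_top. \<forall>m. s * L ^ d \<le> real m \<longrightarrow> real m \<le> t * L ^ d \<longrightarrow>
      a m \<le> ennreal c * F L + ennreal (c - 1))" if c: "c > 1" for c :: real
  proof -
    \<comment> \<open>The factor \<open>c\<close> is split into two factors \<open>sqrt c\<close>:
      one pays for \<open>t powr q\<close> when \<open>real m powr q\<close> is compared with
      \<open>L powr p\<close>, the other for the lost probability. The window now lies above 1, and
      \<open>\<epsilon>\<close> satisfies both \<open>1 + \<epsilon> \<le> s\<close> and the bound
      \<open>\<epsilon> \<le> 1\<close> of the concentration estimate.\<close>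
    define t where "t = sqrt c powr (1 / q)"
    define s where "s = sqrt t"
    define \<epsilon> where "\<epsilon> = min 1 (s - 1)"
    have t1: "t > 1" using c q by (simp add: t_def gr_one_powr)
    have s: "1 < s" "s < t" using t1 by (auto simp: s_def power2_eq_square intro!: real_less_lsqrt)
    have e: "0 < \<epsilon>" "\<epsilon> \<le> 1" using s by (auto simp: \<epsilon>_def)
    have tq: "t powr q = sqrt c" using q c by (simp add: t_def powr_powr)
    have "((\<lambda>r. 1 - 2 * real CARD('k) * exp (- (\<epsilon>\<^sup>2 / 4 * r))) \<longlongrightarrow> 1) at_top"
      using e by real_asymp
    then have "\<forall>\<^sub>F r in at_top. 1 - 2 * real CARD('k) * exp (- (\<epsilon>\<^sup>2 / 4 * r)) > 1 / sqrt c"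
      using c by (intro order_tendstoD) auto
    from eventually_compose_filterlim[OF this pow] eventually_gt_at_top[of 0]
    have "\<forall>\<^sub>F L in at_top. \<forall>m. s * L ^ d \<le> real m \<longrightarrow> real m \<le> t * L ^ d \<longrightarrow>
        a m \<le> ennreal c * F L + ennreal (c - 1)"
    proof eventually_elim
      case (elim L)
      let ?b = "1 - 2 * real CARD('k) * exp (- (\<epsilon>\<^sup>2 / 4 * L ^ d))"
      show ?case
      proof (intro allI impI)
        fix m assume m: "s * L ^ d \<le> real m" "real m \<le> t * L ^ d"
        have "real m powr q \<le> (t * L ^ d) powr q"
          using q m by (intro powr_mono2) auto
        also have "\<dots> = sqrt c * L powr p"
          using t1 elim(2) tq by (simp add: Lp powr_mult)
        also have "sqrt c \<le> c * ?b"
        proof -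
          have "c * (1 / sqrt c) \<le> c * ?b" using elim(1) c by (intro mult_left_mono) auto
          then show ?thesis using c by (simp add: real_div_sqrt)
        qed
        finally have "real m powr q \<le> c * ?b * L powr p" by (simp add: mult_right_mono)
        then have "real m powr q * f 1 (\<lambda>_. m) \<le> c * ?b * L powr p * f 1 (\<lambda>_. m)"
          by (intro mult_right_mono nonneg) auto
        then have "a m \<le> ennreal (c * (f L (\<lambda>_. m) * ?b))"
          unfolding a_def using elim(2) by (intro ennreal_leI) (simp add: homogeneity[of L] mult_ac)
        also have "\<dots> = ennreal c * ennreal (f L (\<lambda>_. m) * ?b)"
          using c by (intro ennreal_mult') auto
        also have "\<dots> \<le> ennreal c * F L"
        proof -
          have "(1 + \<epsilon>) * L ^ d \<le> s * L ^ d"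
            using elim(2) by (intro mult_right_mono) (auto simp: \<epsilon>_def)
          then have m': "(1 + \<epsilon>) * L ^ d \<le> real m" using m(1) by (rule order_trans)
          have "ennreal (f L (\<lambda>_. m) * ?b) \<le> F L"
            unfolding F_def
          proof (rule mean_at_lower[OF poisson[OF elim(2)] _ e _ _ m'])
            show "f L n \<le> f L m" if "\<And>i. m i \<le> n i" for m n
              using elim(2) that by (rule mono)
          qed (use elim(2) nonneg in simp_all)
          then show ?thesis by (intro mult_left_mono) simp_all
        qed
        \<comment> \<open>The estimate so far is purely multiplicative; the term
          \<open>c - 1\<close> is added to match the form of \<open>upper\<close>.\<close>
        finally show "a m \<le> ennreal c * F L + ennreal (c - 1)"
          by (simp add: add_increasing2)
      qed
    qed
    then show ?thesis using s by (meson less_trans zero_less_one)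
  qed

  have up: "Limsup at_top F \<le> ennreal c * Limsup sequentially a + ennreal (c - 1)
      \<and> Liminf at_top F \<le> ennreal c * Liminf sequentially a + ennreal (c - 1)" if c: "c > 1" for c :: real
  proof -
    from upper[OF c] obtain s t where st: "0 < s" "s < t"
      and ev: "\<forall>\<^sub>F L in at_top. \<forall>m. s * L ^ d \<le> real m \<longrightarrow> real m \<le> t * L ^ d \<longrightarrow>
        F L \<le> ennreal c * a m + ennreal (c - 1)" by blast
    from comparable_scales[OF d st ev] obtain \<mu> \<nu> where
      \<mu>: "filterlim \<mu> sequentially at_top" "\<forall>\<^sub>F L in at_top. F L \<le> ennreal c * a (\<mu> L) + ennreal (c - 1)" and
      \<nu>: "filterlim \<nu> at_top sequentially" "\<forall>\<^sub>F n in sequentially. F (\<nu> n) \<le> ennreal c * a n + ennreal (c - 1)"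
      by blast
    show ?thesis
      \<comment> \<open>The upper limit over \<open>L\<close> samples \<open>a\<close> along
        \<open>\<mu>\<close>; the lower limit samples \<open>F\<close> along
        \<open>\<nu>\<close>.\<close>
      using Limsup_le_affine_ennreal[OF \<mu>(1) _ _ \<mu>(2)] Liminf_le_affine_ennreal[OF \<nu>(1) _ _ \<nu>(2)]
      by simp
  qed
  have low: "Limsup sequentially a \<le> ennreal c * Limsup at_top F + ennreal (c - 1)
      \<and> Liminf sequentially a \<le> ennreal c * Liminf at_top F + ennreal (c - 1)" if c: "c > 1" for c :: real
  proof -
    from lower[OF c] obtain s t where st: "0 < s" "s < t"
      and ev: "\<forall>\<^sub>F L in at_top. \<forall>m. s * L ^ d \<le> real m \<longrightarrow> real m \<le> t * L ^ d \<longrightarrow>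
        a m \<le> ennreal c * F L + ennreal (c - 1)" by blast
    from comparable_scales[OF d st ev] obtain \<mu> \<nu> where
      \<mu>: "filterlim \<mu> sequentially at_top" "\<forall>\<^sub>F L in at_top. a (\<mu> L) \<le> ennreal c * F L + ennreal (c - 1)" and
      \<nu>: "filterlim \<nu> at_top sequentially" "\<forall>\<^sub>F n in sequentially. a n \<le> ennreal c * F (\<nu> n) + ennreal (c - 1)"
      by blast
    show ?thesis
      \<comment> \<open>With \<open>a\<close> and \<open>F\<close> exchanged, \<open>\<mu>\<close>
        and \<open>\<nu>\<close> exchange their roles as well.\<close>
      using Limsup_le_affine_ennreal[OF \<nu>(1) _ _ \<nu>(2)] Liminf_le_affine_ennreal[OF \<mu>(1) _ _ \<mu>(2)]
      by simp
  qed
  have "Liminf sequentially a = Liminf at_top F" "Limsup sequentially a = Limsup at_top F"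
    using up low by (blast intro: antisym ennreal_le_affine_limit)+
  then show ?thesis by (simp add: a_def[abs_def] F_def[abs_def] q_def)
qed

end
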